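(* Let ${\bf x}=(x_1,\dots,x_n)$, $\overline{{\bf x}}=(\overline{x}_1,\dots,\overline{x}_n)$ with $\overline{x}_k=x_k^{-1}$, and for $i=1,\dots,n$ let ${\bf x}^{(i)}=(x_i,x_{i+1},\dots,x_n)$ and $\overline{{\bf x}}^{(i)}=(\overline{x}_i,\dots,\overline{x}_n)$. Then for any partition $\lambda=(\lambda_1,\dots,\lambda_n)$ of length at most $n$ and any ${\bf a}=(a_1,a_2,\ldots)$, with $n\times n$ determinants whose $(i,j)$ entry is displayed, $$gl_\lambda({\bf x}|{\bf a})=\left|\,h^{gl}_{\lambda_j-j+i}({\bf x}^{(i)}|{\bf a})\,\right|,\qquad sp_\lambda({\bf x},\overline{{\bf x}}|{\bf a})=\left|\,h^{sp}_{\lambda_j-j+i}({\bf x}^{(i)},\overline{{\bf x}}^{(i)}|{\bf a})\,\right|,$$ $$so_\lambda({\bf x},\overline{{\bf x}},1|{\bf a})=\left|\,h^{oo}_{\lambda_j-j+i}({\bf x}^{(i)},\overline{{\bf x}}^{(i)},1|{\bf a})\,\right|,\qquad o_\lambda({\bf x},\overline{{\bf x}}|{\bf a})=\left|\,h^{eo}_{\lambda_j-j+i}({\bf x}^{(i)},\overline{{\bf x}}^{(i)}|{\bf a})\,\right|.$$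
   Context: For an indeterminate $y$ and integer $m\ge0$, $(y|{\bf a})^m=(y+a_1)\cdots(y+a_m)$ for $m>0$ and $(y|{\bf a})^0=1$. The factorial characters are ($n\times n$ determinants, $(i,j)$ entry shown): $gl_\lambda({\bf x}|{\bf a})=\left|(x_i|{\bf a})^{\lambda_j+n-j}\right|/\left|(x_i|{\bf a})^{n-j}\right|$; $sp_\lambda({\bf x},\overline{{\bf x}}|{\bf a})=\left|x_i(x_i|{\bf a})^{\lambda_j+n-j}-\overline{x}_i(\overline{x}_i|{\bf a})^{\lambda_j+n-j}\right|/\left|x_i(x_i|{\bf a})^{n-j}-\overline{x}_i(\overline{x}_i|{\bf a})^{n-j}\right|$; $so_\lambda({\bf x},\overline{{\bf x}},1|{\bf a})=\left|x_i^{1/2}(x_i|{\bf a})^{\lambda_j+n-j}-\overline{x}_i^{1/2}(\overline{x}_i|{\bf a})^{\lambda_j+n-j}\right|/\left|x_i^{1/2}(x_i|{\bf a})^{n-j}-\overline{x}_i^{1/2}(\overline{x}_i|{\bf a})^{n-j}\right|$; $o_\lambda({\bf x},\overline{{\bf x}}|{\bf a})=\eta\left|(x_i|{\bf a})^{\lambda_j+n-j}+(\overline{x}_i|{\bf a})^{\lambda_j+n-j}\right|/\big(\tfrac12\left|(x_i|{\bf a})^{n-j}+(\overline{x}_i|{\bf a})^{n-j}\right|\big)$ with $\eta=\tfrac12$ if $\lambda_n=0$ and $\eta=1$ if $\lambda_n>0$. $[t^m]F(t)$ is the coefficient of $t^m$. For a list of $p\ge1$ variables ${\bf y}=(y_1,\dots,y_p)$,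 $\overline{y}_k=y_k^{-1}$, and any integer $m$: $h^{gl}_m({\bf y}|{\bf a})=[t^m]\prod_{k=1}^p\frac{1}{1-ty_k}\prod_{l=1}^{p+m-1}(1+ta_l)$; $h^{sp}_m({\bf y},\overline{{\bf y}}|{\bf a})=[t^m]\prod_{k=1}^p\frac{1}{(1-ty_k)(1-t\overline{y}_k)}\prod_{l=1}^{p+m-1}(1+ta_l)$; $h^{oo}_m({\bf y},\overline{{\bf y}},1|{\bf a})=[t^m](1+t)\prod_{k=1}^p\frac{1}{(1-ty_k)(1-t\overline{y}_k)}\prod_{l=1}^{p+m-1}(1+ta_l)$; $h^{eo}_m({\bf y},\overline{{\bf y}}|{\bf a})=[t^m]\big(\frac{1}{1-ty_1}+\frac{1}{1-t\overline{y}_1}-\delta_{m0}\big)\prod_{l=1}^{m}(1+ta_l)$ if $p=1$, and $[t^m](1-t^2)\prod_{k=1}^p\frac{1}{(1-ty_k)(1-t\overline{y}_k)}\prod_{l=1}^{p+m-1}(1+ta_l)$ if $p>1$ ($\delta_{m0}=1$ if $m=0$, else $0$). All of these equal $1$ for $m=0$ and $0$ for $m<0$. *)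

theory Defs
  imports
    "HOL-Computational_Algebra.Formal_Power_Series"
    "Jordan_Normal_Form.Determinant"
begin

text \<open>
  All families of variables, parameters and parts are indexed from 1. Indeterminates are rendered
  by arbitrary elements of a field, so that a quotient of determinants is meaningful exactly when
  its denominator does not vanish. The denominators are therefore named separately.
\<close>

text \<open>The $n \times n$ determinant with $(i,j)$ entry \<open>f i j\<close>, for $1 \le i, j \le n$.\<close>

definition det1 :: "nat \<Rightarrow> (nat \<Rightarrow> nat \<Rightarrow> 'a::comm_ring_1) \<Rightarrow> 'a" where
  "det1 n f = det (mat n n (\<lambda>(i, j). f (Suc i) (Suc j)))"

definition factorial_power :: "'a::comm_ring_1 \<Rightarrow> (nat \<Rightarrow> 'a) \<Rightarrow> nat \<Rightarrow> 'a" where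
  "factorial_power y a m = (\<Prod>l=1..m. y + a l)"


subsection \<open>Factorial characters\<close>

definition gl_den :: "nat \<Rightarrow> (nat \<Rightarrow> 'a::field) \<Rightarrow> (nat \<Rightarrow> 'a) \<Rightarrow> 'a" where
  "gl_den n x a = det1 n (\<lambda>i j. factorial_power (x i) a (n - j))"

definition gl_char :: "nat \<Rightarrow> (nat \<Rightarrow> nat) \<Rightarrow> (nat \<Rightarrow> 'a::field) \<Rightarrow> (nat \<Rightarrow> 'a) \<Rightarrow> 'a" where
  "gl_char n lam x a =
     det1 n (\<lambda>i j. factorial_power (x i) a (lam j + n - j)) / gl_den n x a"

definition sp_den :: "nat \<Rightarrow> (nat \<Rightarrow> 'a::field) \<Rightarrow> (nat \<Rightarrow> 'a) \<Rightarrow> 'a" where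
  "sp_den n x a =
     det1 n (\<lambda>i j. x i * factorial_power (x i) a (n - j)
                 - inverse (x i) * factorial_power (inverse (x i)) a (n - j))"

definition sp_char :: "nat \<Rightarrow> (nat \<Rightarrow> nat) \<Rightarrow> (nat \<Rightarrow> 'a::field) \<Rightarrow> (nat \<Rightarrow> 'a) \<Rightarrow> 'a" where
  "sp_char n lam x a =
     det1 n (\<lambda>i j. x i * factorial_power (x i) a (lam j + n - j)
                 - inverse (x i) * factorial_power (inverse (x i)) a (lam j + n - j))
     / sp_den n x a"

text \<open>
  In the odd orthogonal case \<open>s i\<close> stands for a square root of \<open>x i\<close>; it is an extra argument,
  to be used under the hypothesis \<open>s i ^ 2 = x i\<close>.
\<close>

definition so_den :: "nat \<Rightarrow> (nat \<Rightarrow> 'a::field) \<Rightarrow> (nat \<Rightarrow> 'a) \<Rightarrow> (nat \<Rightarrow> 'a) \<Rightarrow> 'a" where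
  "so_den n s x a =
     det1 n (\<lambda>i j. s i * factorial_power (x i) a (n - j)
                 - inverse (s i) * factorial_power (inverse (x i)) a (n - j))"

definition so_char ::
  "nat \<Rightarrow> (nat \<Rightarrow> nat) \<Rightarrow> (nat \<Rightarrow> 'a::field) \<Rightarrow> (nat \<Rightarrow> 'a) \<Rightarrow> (nat \<Rightarrow> 'a) \<Rightarrow> 'a" where
  "so_char n lam s x a =
     det1 n (\<lambda>i j. s i * factorial_power (x i) a (lam j + n - j)
                 - inverse (s i) * factorial_power (inverse (x i)) a (lam j + n - j))
     / so_den n s x a"

definition o_den :: "nat \<Rightarrow> (nat \<Rightarrow> 'a::field) \<Rightarrow> (nat \<Rightarrow> 'a) \<Rightarrow> 'a" where
  "o_den n x a =
     1 / 2 * det1 n (\<lambda>i j. factorial_power (x i) a (n - j)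
                         + factorial_power (inverse (x i)) a (n - j))"

definition o_char :: "nat \<Rightarrow> (nat \<Rightarrow> nat) \<Rightarrow> (nat \<Rightarrow> 'a::field) \<Rightarrow> (nat \<Rightarrow> 'a) \<Rightarrow> 'a" where
  "o_char n lam x a =
     (if lam n = 0 then 1 / 2 else 1) *
     det1 n (\<lambda>i j. factorial_power (x i) a (lam j + n - j)
                 + factorial_power (inverse (x i)) a (lam j + n - j))
     / o_den n x a"


subsection \<open>One-part functions\<close>

text \<open>
  The coefficient of $t^m$ for an integer $m$, which is 0 for negative $m$. The series itself
  depends on $m$ through the number of factors $1 + t a_l$; for $m \ge 0$ and a nonempty list
  of $p$ variables the truncated difference below is the true value of $p + m - 1$.
\<close>

definition coeff_int :: "'a::zero fps \<Rightarrow> int \<Rightarrow> 'a" where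
  "coeff_int F m = (if m < 0 then 0 else fps_nth F (nat m))"

definition geom :: "'a::field \<Rightarrow> 'a fps" where
  "geom y = inverse (1 - fps_X * fps_const y)"

definition param_prod :: "(nat \<Rightarrow> 'a::field) \<Rightarrow> nat \<Rightarrow> 'a fps" where
  "param_prod a q = (\<Prod>l=1..q. 1 + fps_X * fps_const (a l))"

definition h_gl :: "int \<Rightarrow> 'a::field list \<Rightarrow> (nat \<Rightarrow> 'a) \<Rightarrow> 'a" where
  "h_gl m ys a =
     coeff_int ((\<Prod>y\<leftarrow>ys. geom y) * param_prod a (length ys + nat m - 1)) m"

definition h_sp :: "int \<Rightarrow> 'a::field list \<Rightarrow> (nat \<Rightarrow> 'a) \<Rightarrow> 'a" where
  "h_sp m ys a =
     coeff_int ((\<Prod>y\<leftarrow>ys. geom y * geom (inverse y)) * param_prod a (length ys + nat m - 1)) m"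

definition h_oo :: "int \<Rightarrow> 'a::field list \<Rightarrow> (nat \<Rightarrow> 'a) \<Rightarrow> 'a" where
  "h_oo m ys a =
     coeff_int ((1 + fps_X) * (\<Prod>y\<leftarrow>ys. geom y * geom (inverse y))
                * param_prod a (length ys + nat m - 1)) m"

definition h_eo :: "int \<Rightarrow> 'a::field list \<Rightarrow> (nat \<Rightarrow> 'a) \<Rightarrow> 'a" where
  "h_eo m ys a =
     (if length ys = 1
      then coeff_int ((geom (hd ys) + geom (inverse (hd ys)) - (if m = 0 then 1 else 0))
                      * param_prod a (nat m)) m
      else coeff_int ((1 - fps_X ^ 2) * (\<Prod>y\<leftarrow>ys. geom y * geom (inverse y))
                      * param_prod a (length ys + nat m - 1)) m)"

text \<open>The list $(x_i, x_{i+1}, \dots, x_n)$.\<close>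

definition vars_from :: "nat \<Rightarrow> (nat \<Rightarrow> 'a) \<Rightarrow> nat \<Rightarrow> 'a list" where
  "vars_from n x i = map x [i..<Suc n]"

end

theory Submission imports Defs begin

no_notation vec_index (infixl "$" 100)
unbundle fps_syntax

text \<open>
  Put \<open>m\<^sub>j = \<lambda>\<^sub>j + n - j\<close>. In row \<open>i\<close>, column \<open>j\<close> of each determinant of one-part functions the
  number of factors \<open>1 + t a\<^sub>l\<close> is \<open>m\<^sub>j\<close>, independently of \<open>i\<close>, so this entry is the coefficient of
  \<open>t^m\<^sub>j\<close> in \<open>t^(n-i) B (\<Prod>k=i..n. 1 / Q\<^sub>k)\<close> times these factors, where \<open>Q\<^sub>k = R - t u\<^sub>k\<close>.
  Since \<open>t / (Q\<^sub>k Q\<^sub>l) = (1 / Q\<^sub>k - 1 / Q\<^sub>l) / (u\<^sub>k - u\<^sub>l)\<close>, partial fractions express it through the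
  entries with a single \<open>1 / Q\<^sub>k\<close>, which are the entries of the numerator up to a factor depending
  on the row. The coefficient matrix does not depend on \<open>\<lambda>\<close>; hence its determinant is read off at
  \<open>\<lambda> = 0\<close>, where the matrix of one-part functions is triangular.
\<close>

section \<open>Determinants with rows and columns numbered from 1\<close>

lemma det1_cong:
  assumes "\<And>i j. 1 \<le> i \<Longrightarrow> i \<le> n \<Longrightarrow> 1 \<le> j \<Longrightarrow> j \<le> n \<Longrightarrow> f i j = g i j"
  shows "det1 n f = det1 n g"
  unfolding det1_def by (intro arg_cong[of _ _ det] eq_matI) (simp_all add: assms)

lemma det1_mult: "det1 n (\<lambda>i j. \<Sum>k=1..n. f i k * g k j) = det1 n f * det1 n g"
proof -
  have "mat n n (\<lambda>(i, j). \<Sum>k=1..n. f (Suc i) k * g k (Suc j)) =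
        mat n n (\<lambda>(i, j). f (Suc i) (Suc j)) * mat n n (\<lambda>(i, j). g (Suc i) (Suc j))"
    by (rule eq_matI)
       (auto simp: scalar_prod_def sum.atLeast1_atMost_eq atLeast0LessThan intro!: sum.cong)
  then show ?thesis
    unfolding det1_def by (simp add: det_mult[of _ n])
qed

lemma det1_lower_triangular:
  assumes "\<And>i j. 1 \<le> i \<Longrightarrow> i < j \<Longrightarrow> j \<le> n \<Longrightarrow> f i j = 0"
  shows "det1 n f = (\<Prod>i=1..n. f i i)"
proof -
  have "det1 n f = prod_list (diag_mat (mat n n (\<lambda>(i, j). f (Suc i) (Suc j))))"
    unfolding det1_def by (rule det_lower_triangular[of n]) (auto simp: assms)
  also have "\<dots> = (\<Prod>i=1..n. f i i)"
    by (simp add: prod_list_diag_prod prod.atLeast1_atMost_eq atLeast0LessThan)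
  finally show ?thesis .
qed

lemma det1_scale_rows: "det1 n (\<lambda>i j. d i * f i j) = (\<Prod>i=1..n. d i) * det1 n f"
proof -
  have "det1 n (\<lambda>i j. d i * f i j) = det1 n (\<lambda>i j. \<Sum>k=1..n. (if k = i then d i else 0) * f k j)"
    by (rule det1_cong) (simp add: if_distrib[of "\<lambda>z. z * _"] cong: if_cong)
  also have "\<dots> = det1 n (\<lambda>i k. if k = i then d i else 0) * det1 n f"
    by (rule det1_mult)
  also have "det1 n (\<lambda>i k. if k = i then d i else 0) = (\<Prod>i=1..n. d i)"
    by (subst det1_lower_triangular) auto
  finally show ?thesis .
qed

lemma det1_scale_cols: "det1 n (\<lambda>i j. f i j * d j) = det1 n f * (\<Prod>j=1..n. d j)"
proof -
  have "det1 n (\<lambda>i j. f i j * d j) = det1 n (\<lambda>i j. \<Sum>k=1..n. f i k * (if k = j then d j else 0))"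
    by (rule det1_cong) (simp add: if_distrib[of "\<lambda>z. _ * z"] cong: if_cong)
  also have "\<dots> = det1 n f * det1 n (\<lambda>k j. if k = j then d j else 0)"
    by (rule det1_mult)
  also have "det1 n (\<lambda>k j. if k = j then d j else 0) = (\<Prod>j=1..n. d j)"
    by (subst det1_lower_triangular) auto
  finally show ?thesis .
qed

lemma det1_identical_rows:
  assumes "i \<in> {1..n}" "k \<in> {1..n}" "i \<noteq> k" "\<And>j. f i j = f k j"
  shows "det1 n f = 0"
  unfolding det1_def
  by (rule det_identical_rows[of _ n "i - 1" "k - 1"]) (use assms in \<open>auto intro!: eq_vecI\<close>)

section \<open>Partial fractions of power series and the resulting flagged determinant\<close>

lemma fps_const_sum: "fps_const (\<Sum>k\<in>A. f k) = (\<Sum>k\<in>A. fps_const (f k))"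
  by (induction A rule: infinite_finite_induct) (simp_all flip: fps_const_add)

lemma fps_prod_nth_0: "(\<Prod>k\<in>A. f k) $ 0 = (\<Prod>k\<in>A. f k $ 0)"
  for f :: "_ \<Rightarrow> 'a::comm_ring_1 fps"
  by (induction A rule: infinite_finite_induct) simp_all

text \<open>Bringing both terms to the common denominator. The case \<open>c = d = 1\<close> drives
  the partial fractions; general \<open>c\<close>, \<open>d\<close> with \<open>R = 1\<close>
  combine the two geometric series in an entry of a numerator.\<close>

lemma linear_combination_inverses:
  fixes W V :: "'a::comm_ring_1"
  assumes "W * (R - t * u) = 1" "V * (R - t * v) = 1"
  shows "c * W - d * V = ((c - d) * R + t * (d * u - c * v)) * (W * V)"
proof -
  have "c * W - d * V = c * W * (V * (R - t * v)) - d * V * (W * (R - t * u))"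
    by (simp add: assms)
  then show ?thesis by (simp add: algebra_simps)
qed

text \<open>Induction on \<open>A\<close>: each further factor is paid for by one power of t, which
  turns a product of two inverses into a difference. Existence of the coefficients is enough, since
  their values never enter.\<close>

lemma partial_fractions:
  fixes R :: "'a::field fps" and u :: "'b \<Rightarrow> 'a"
  assumes "R $ 0 \<noteq> 0" "finite A" "A \<noteq> {}" "inj_on u A"
  shows "\<exists>c. fps_X ^ (card A - 1) * (\<Prod>k\<in>A. inverse (R - fps_X * fps_const (u k))) =
             (\<Sum>k\<in>A. fps_const (c k) * inverse (R - fps_X * fps_const (u k)))"
  using assms(2,3,4)
proof (induction A rule: finite_ne_induct)
  case (singleton k)
  show ?case by (intro exI[of _ "\<lambda>_. 1"]) simp
next
  case (insert y A)
  define W where "W k = inverse (R - fps_X * fps_const (u k))" for k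
  have W: "W k * (R - fps_X * fps_const (u k)) = 1" for k
    unfolding W_def using assms(1) by (intro inverse_mult_eq_1) simp
  from insert obtain c where
    c: "fps_X ^ (card A - 1) * (\<Prod>k\<in>A. W k) = (\<Sum>k\<in>A. fps_const (c k) * W k)"
    unfolding W_def by auto
  \<comment> \<open>From \<open>W y - W k = t (u y - u k) W y W k\<close>, the division being
    legitimate because \<open>u\<close> is injective.\<close>
  define b where "b k = c k / (u y - u k)" for k
  have step: "fps_X * W y * (fps_const (c k) * W k) = fps_const (b k) * (W y - W k)"
    if "k \<in> A" for k
  proof -
    have "u y \<noteq> u k" using insert that by (auto simp: inj_on_def)
    then have "fps_const (c k) = fps_const (b k) * (fps_const (u y) - fps_const (u k))"
      by (simp add: b_def)
    moreover have "fps_X * (fps_const (u y) - fps_const (u k)) * W y * W k = W y - W k"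
      using linear_combination_inverses[OF W[of y] W[of k], of 1 1] by (simp add: mult_ac)
    moreover have "fps_X * W y * (fps_const (b k) * (fps_const (u y) - fps_const (u k)) * W k) =
        fps_const (b k) * (fps_X * (fps_const (u y) - fps_const (u k)) * W y * W k)"
      by (simp only: mult_ac)
    ultimately show ?thesis by (simp only:)
  qed
  have "fps_X ^ (card (insert y A) - 1) * (\<Prod>k\<in>insert y A. W k) =
        fps_X * W y * (fps_X ^ (card A - 1) * (\<Prod>k\<in>A. W k))"
  proof -
    \<comment> \<open>\<open>A\<close> is nonempty, so the truncated \<open>card A - 1\<close> is a
      true difference.\<close>
    have "card A = Suc (card A - 1)" using insert by (simp add: card_gt_0_iff)
    then have "fps_X ^ card A = fps_X * (fps_X ^ (card A - 1) :: 'a fps)"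
      by (metis power_Suc)
    then show ?thesis using insert by (simp add: mult_ac)
  qed
  also have "\<dots> = (\<Sum>k\<in>A. fps_const (b k) * (W y - W k))"
    unfolding c sum_distrib_left by (rule sum.cong) (auto simp: step)
  also have "\<dots> = (\<Sum>k\<in>A. fps_const (b k)) * W y + (\<Sum>k\<in>A. fps_const (- b k) * W k)"
    by (simp add: sum_distrib_right right_diff_distrib sum_subtractf sum_negf flip: fps_const_neg)
  also have "(\<Sum>k\<in>A. fps_const (b k)) = fps_const (\<Sum>k\<in>A. b k)"
    by (rule fps_const_sum[symmetric])
  also have "fps_const (\<Sum>k\<in>A. b k) * W y + (\<Sum>k\<in>A. fps_const (- b k) * W k) =
      (\<Sum>k\<in>insert y A. fps_const (if k = y then \<Sum>k\<in>A. b k else - b k) * W k)"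
  proof -
    have "(\<Sum>k\<in>A. fps_const (- b k) * W k) =
        (\<Sum>k\<in>A. fps_const (if k = y then \<Sum>k\<in>A. b k else - b k) * W k)"
      using \<open>y \<notin> A\<close> by (intro sum.cong) auto
    then show ?thesis using insert by simp
  qed
  finally show ?case
    unfolding W_def by (rule exI[of _ "\<lambda>k. if k = y then \<Sum>k\<in>A. b k else - b k"])
qed

text \<open>
  The summand \<open>e\<close> serves the even orthogonal case: the constant terms in the partial fraction
  decomposition show that it survives in the last row only.
\<close>

lemma det1_flagged:
  fixes R B e :: "'a::field fps" and u :: "nat \<Rightarrow> 'a" and P :: "nat \<Rightarrow> 'a fps" and n :: nat
  defines "W k \<equiv> inverse (R - fps_X * fps_const (u k))"
  defines "F i q \<equiv> ((e + B * W i) * P q) $ q"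
  defines "H i q \<equiv> (((if i = n then e else 0) + fps_X ^ (n - i) * (B * (\<Prod>k=i..n. W k))) * P q) $ q"
  assumes R: "R $ 0 = 1" and B: "B $ 0 = 1" and P: "\<And>q. P q $ 0 = 1" and n: "n \<ge> 1"
    and F0: "det1 n (\<lambda>i j. F i (n - j)) \<noteq> 0"
  shows "det1 n (\<lambda>i j. H i (m j)) * det1 n (\<lambda>i j. F i (n - j)) =
         (1 + e $ 0) * det1 n (\<lambda>i j. F i (m j))"
proof -
  \<comment> \<open>Row \<open>i\<close> of \<open>F\<close> depends on \<open>i\<close> only
    through \<open>u i\<close>; two equal values would give two equal rows, against
    \<open>F0\<close>.\<close>
  have inj: "inj_on u {1..n}"
  proof (rule inj_onI, rule ccontr)
    fix i k assume "i \<in> {1..n}" "k \<in> {1..n}" "u i = u k" "i \<noteq> k"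
    then have "det1 n (\<lambda>i j. F i (n - j)) = 0"
      by (intro det1_identical_rows[of i n k]) (auto simp: F_def W_def)
    with F0 show False by contradiction
  qed
  have W0: "W k $ 0 = 1" for k by (simp add: W_def R)
  have "\<exists>c. fps_X ^ (n - i) * (\<Prod>k=i..n. W k) = (\<Sum>k=i..n. fps_const (c k) * W k)"
    if "i \<in> {1..n}" for i
    using partial_fractions[of R "{i..n}" u] that R inj_on_subset[OF inj, of "{i..n}"]
    by (auto simp: W_def)
  then obtain c where c:
    "\<And>i. i \<in> {1..n} \<Longrightarrow> fps_X ^ (n - i) * (\<Prod>k=i..n. W k) = (\<Sum>k=i..n. fps_const (c i k) * W k)"
    by metis
  \<comment> \<open>Extended by zero below the diagonal, the coefficients form an upper triangular
    matrix, and the passage from \<open>F\<close> to \<open>H\<close> becomes a matrix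
    product.\<close>
  define C where "C i k = (if i \<le> k then c i k else 0)" for i k
  have H: "H i q = (\<Sum>k=1..n. C i k * F k q)" if i: "i \<in> {1..n}" for i q
  proof -
    have "(\<Sum>k=i..n. c i k) = (fps_X ^ (n - i) * (\<Prod>k=i..n. W k)) $ 0"
      by (subst c[OF i]) (simp add: fps_sum_nth W0)
    also have "\<dots> = (if i = n then 1 else 0)"
      using i by (auto simp: W0)
    finally have c1: "(\<Sum>k=i..n. fps_const (c i k)) = (if i = n then 1 else 0)"
      by (simp flip: fps_const_sum)
    have "(if i = n then e else 0) + fps_X ^ (n - i) * (B * (\<Prod>k=i..n. W k)) =
          (\<Sum>k=i..n. fps_const (c i k)) * e + B * (fps_X ^ (n - i) * (\<Prod>k=i..n. W k))"
      unfolding c1 by (simp add: mult_ac)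
    also have "\<dots> = (\<Sum>k=i..n. fps_const (c i k) * (e + B * W k))"
      unfolding c[OF i]
      by (simp add: sum_distrib_left sum_distrib_right sum.distrib algebra_simps)
    finally have "H i q = (\<Sum>k=i..n. c i k * F k q)"
      unfolding H_def F_def by (simp add: sum_distrib_right fps_sum_nth mult.assoc)
    also have "\<dots> = (\<Sum>k=1..n. C i k * F k q)"
      using i by (intro sum.mono_neutral_cong_left) (auto simp: C_def)
    finally show ?thesis .
  qed
  \<comment> \<open>One matrix \<open>C\<close> serves all exponents \<open>q\<close>. Using this
    for \<open>m\<close> and for \<open>n - j\<close> eliminates \<open>det1 n C\<close>.\<close>
  have HF: "det1 n (\<lambda>i j. H i (q j)) = det1 n C * det1 n (\<lambda>i j. F i (q j))" for q
    unfolding det1_mult[symmetric] by (rule det1_cong) (simp add: H)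
  \<comment> \<open>Above the diagonal the factor \<open>t^(n-i)\<close> exceeds the degree
    \<open>n - j\<close> that is read off. On the diagonal only constant terms remain, and
    \<open>e\<close> contributes at \<open>i = n\<close> alone.\<close>
  have "det1 n (\<lambda>i j. H i (n - j)) = (\<Prod>i=1..n. H i (n - i))"
    by (rule det1_lower_triangular)
       (simp add: H_def mult.assoc fps_X_power_mult_nth)
  also have "\<dots> = (\<Prod>i=1..n. if i = n then 1 + e $ 0 else 1)"
    by (rule prod.cong) (auto simp: H_def mult.assoc fps_X_power_mult_nth P B W0 fps_prod_nth_0)
  also have "\<dots> = 1 + e $ 0"
    using n by simp
  finally show ?thesis
    using HF[of m] HF[of "\<lambda>j. n - j"] by (simp add: mult_ac)
qed

section \<open>Factorial powers and one-part functions as coefficients of power series\<close>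

lemma param_prod_Suc: "param_prod a (Suc q) = param_prod a q * (1 + fps_X * fps_const (a (Suc q)))"
  by (simp add: param_prod_def)

lemma param_prod_nth_0: "param_prod a q $ 0 = 1"
  by (induction q) (simp_all add: param_prod_Suc, simp add: param_prod_def)

lemma param_prod_nth_eq_0: "q < k \<Longrightarrow> param_prod a q $ k = 0"
proof (induction q arbitrary: k)
  case 0
  then show ?case by (simp add: param_prod_def)
next
  case (Suc q)
  then show ?case
    by (cases k) (simp_all add: param_prod_Suc distrib_left fps_mult_right_const_nth flip: mult.assoc)
qed

lemma geom_mult: "geom y * (1 - fps_X * fps_const y) = 1"
  unfolding geom_def by (rule inverse_mult_eq_1) simp

text \<open>A factorial power is the function \<open>h_gl\<close> of a single variable. In the
  induction, \<open>param_prod a q\<close> has degree at most \<open>q\<close>, so the next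
  coefficient of \<open>G\<close> is \<open>y\<close> times the previous one; the new factor then
  adds \<open>a (Suc q)\<close> times the same coefficient.\<close>

lemma factorial_power_eq: "factorial_power y a q = (geom y * param_prod a q) $ q"
proof (induction q)
  case 0
  show ?case by (simp add: factorial_power_def param_prod_def geom_def)
next
  case (Suc q)
  define G where "G = geom y * param_prod a q"
  have "G = param_prod a q + fps_X * (fps_const y * G)"
  proof -
    have "geom y = 1 + fps_X * (fps_const y * geom y)"
      using geom_mult[of y] by (simp add: algebra_simps)
    then have "G = (1 + fps_X * (fps_const y * geom y)) * param_prod a q"
      unfolding G_def by (rule arg_cong)
    also have "\<dots> = param_prod a q + fps_X * (fps_const y * G)"
      unfolding G_def by (simp only: distrib_right mult_1_left mult.assoc)
    finally show ?thesis .
  qed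
  then have "G $ Suc q = (param_prod a q + fps_X * (fps_const y * G)) $ Suc q"
    by (rule arg_cong)
  then have "G $ Suc q = y * G $ q"
    by (simp add: param_prod_nth_eq_0)
  moreover have "geom y * param_prod a (Suc q) = G + fps_X * (fps_const (a (Suc q)) * G)"
    unfolding param_prod_Suc G_def by (simp add: algebra_simps)
  ultimately have "(geom y * param_prod a (Suc q)) $ Suc q = (y + a (Suc q)) * G $ q"
    by (simp add: distrib_right)
  then show ?case
    using Suc by (simp add: G_def factorial_power_def)
qed

text \<open>The denominator takes the form \<open>R - t u\<close> with \<open>R = 1 + t^2\<close>
  common to all variables, as the partial fractions require.\<close>

lemma geom_mult_geom_inverse:
  assumes "y \<noteq> 0"
  shows "geom y * geom (inverse y) = inverse (1 + fps_X ^ 2 - fps_X * fps_const (y + inverse y))"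
proof -
  have "geom y * geom (inverse y) =
    inverse ((1 - fps_X * fps_const y) * (1 - fps_X * fps_const (inverse y)))"
    unfolding geom_def by (simp add: fps_inverse_mult)
  also have "(1 - fps_X * fps_const y) * (1 - fps_X * fps_const (inverse y)) =
    1 + fps_X ^ 2 - fps_X * fps_const (y + inverse y)"
  proof -
    have "fps_const y * fps_const (inverse y) = 1"
      using assms by simp
    then have "fps_X * fps_const y * (fps_X * fps_const (inverse y)) = fps_X ^ 2"
      by (metis mult.left_commute mult.commute mult_1_right power2_eq_square)
    then show ?thesis
      by (simp add: algebra_simps flip: fps_const_add)
  qed
  finally show ?thesis .
qed

text \<open>The list has \<open>n - i + 1\<close> variables, so for \<open>k \<ge> 0\<close> the
  number of parameters is \<open>l + n - j\<close>, free of \<open>i\<close>, and the index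
  \<open>k\<close> falls short of it by \<open>n - i\<close>; the power of t makes up for this. If
  \<open>k < 0\<close>, then \<open>l + n - j < n - i\<close> and both sides vanish.\<close>

lemma coeff_int_param_prod:
  assumes "1 \<le> i" "i \<le> n" "j \<le> n" "k = int l - int j + int i"
  shows "coeff_int (S * param_prod a (length (vars_from n x i) + nat k - 1)) k =
         (fps_X ^ (n - i) * S * param_prod a (l + n - j)) $ (l + n - j)"
proof (cases "k < 0")
  case True
  then show ?thesis using assms by (simp add: coeff_int_def mult.assoc fps_X_power_mult_nth)
next
  case False
  then have "l + n - j = n - i + nat k" "length (vars_from n x i) + nat k - 1 = l + n - j"
    using assms by (auto simp: vars_from_def)
  then show ?thesis
    using False by (simp add: coeff_int_def mult.assoc fps_X_power_mult_nth)
qed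

lemma prod_list_vars_from: "(\<Prod>y\<leftarrow>vars_from n x i. g y) = (\<Prod>k=i..n. g (x k))"
proof -
  have "(\<Prod>k\<in>set [i..<Suc n]. g (x k)) = (\<Prod>k\<leftarrow>[i..<Suc n]. g (x k))"
    by (rule prod.distinct_set_conv_list) simp
  then show ?thesis
    by (simp add: vars_from_def comp_def atLeastLessThanSuc_atLeastAtMost del: upt_Suc)
qed

section \<open>General linear characters\<close>

lemma gl_factorial_flagged:
  assumes n: "n \<ge> 1" and den: "gl_den n x a \<noteq> 0"
  shows "gl_char n lam x a
           = det1 n (\<lambda>i j. h_gl (int (lam j) - int j + int i) (vars_from n x i) a)"
proof -
  \<comment> \<open>The zeros and ones display the instance \<open>R = 1\<close>,
    \<open>B = 1\<close>, \<open>e = 0\<close>, \<open>u = x\<close> of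
    \<open>det1_flagged\<close>.\<close>
  define F H where "F i q = ((0 + 1 * geom (x i)) * param_prod a q) $ q"
    and "H i q = (((if i = n then 0 else 0) + fps_X ^ (n - i) * (1 * (\<Prod>k=i..n. geom (x k))))
                    * param_prod a q) $ q" for i q
  have F: "factorial_power (x i) a q = F i q" for i q
    by (simp add: F_def factorial_power_eq)
  have H: "det1 n (\<lambda>i j. h_gl (int (lam j) - int j + int i) (vars_from n x i) a) =
           det1 n (\<lambda>i j. H i (lam j + n - j))"
    by (rule det1_cong) (simp add: h_gl_def coeff_int_param_prod prod_list_vars_from H_def del: One_nat_def)
  have "det1 n (\<lambda>i j. H i (lam j + n - j)) * det1 n (\<lambda>i j. F i (n - j)) =
        (1 + 0 $ 0) * det1 n (\<lambda>i j. F i (lam j + n - j))"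
    using n den unfolding F_def H_def geom_def gl_den_def factorial_power_eq
    by (intro det1_flagged) (auto simp: param_prod_nth_0)
  then show ?thesis
    using den unfolding gl_char_def gl_den_def F H by (simp add: field_simps)
qed

section \<open>Symplectic and orthogonal characters\<close>

text \<open>The instance \<open>R = 1 + t^2\<close>, \<open>u k = x k + inverse (x k)\<close> of
  \<open>det1_flagged\<close>. The rewriting is confined to indices in \<open>{1..n}\<close>, where
  \<open>x k\<close> is known to be nonzero.\<close>

lemma det1_flagged_symplectic:
  fixes x a :: "nat \<Rightarrow> 'a::field" and B e :: "'a fps" and n :: nat
  defines "F i q \<equiv> ((e + B * (geom (x i) * geom (inverse (x i)))) * param_prod a q) $ q"
  defines "H i q \<equiv> (((if i = n then e else 0) +
     fps_X ^ (n - i) * (B * (\<Prod>k=i..n. geom (x k) * geom (inverse (x k))))) * param_prod a q) $ q"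
  assumes x: "\<forall>i\<in>{1..n}. x i \<noteq> 0" and B: "B $ 0 = 1" and n: "n \<ge> 1"
    and F0: "det1 n (\<lambda>i j. F i (n - j)) \<noteq> 0"
  shows "det1 n (\<lambda>i j. H i (m j)) * det1 n (\<lambda>i j. F i (n - j)) =
         (1 + e $ 0) * det1 n (\<lambda>i j. F i (m j))"
proof -
  define W where "W k = inverse (1 + fps_X ^ 2 - fps_X * fps_const (x k + inverse (x k)))" for k
  have W: "geom (x k) * geom (inverse (x k)) = W k" if "k \<in> {1..n}" for k
    using x that by (simp add: W_def geom_mult_geom_inverse)
  have F: "det1 n (\<lambda>i j. F i (q j)) =
           det1 n (\<lambda>i j. ((e + B * W i) * param_prod a (q j)) $ q j)" for q
    by (rule det1_cong) (simp add: F_def W)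
  have H: "det1 n (\<lambda>i j. H i (m j)) = det1 n (\<lambda>i j. (((if i = n then e else 0) +
     fps_X ^ (n - i) * (B * (\<Prod>k=i..n. W k))) * param_prod a (m j)) $ m j)"
  proof (rule det1_cong)
    fix i j :: nat assume "1 \<le> i"
    then have "(\<Prod>k=i..n. geom (x k) * geom (inverse (x k))) = (\<Prod>k=i..n. W k)"
      by (intro prod.cong) (auto simp: W)
    then show "H i (m j) = (((if i = n then e else 0) +
        fps_X ^ (n - i) * (B * (\<Prod>k=i..n. W k))) * param_prod a (m j)) $ m j"
      by (simp add: H_def)
  qed
  show ?thesis
    using F0 n B unfolding F H W_def by (intro det1_flagged) (auto simp: param_prod_nth_0)
qed

text \<open>Over the common denominator the entry has numerator
  \<open>(c i - d i) + t (d i * x i - c i * inverse (x i))\<close>. The hypothesis makes this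
  \<open>(c i - d i) (1 + b t)\<close>, so a factor independent of the column leaves each row. The
  symplectic case has \<open>b = 0\<close>, the odd orthogonal one \<open>b = 1\<close>.\<close>

lemma det1_factorial_difference:
  fixes x a c d :: "nat \<Rightarrow> 'a::field"
  assumes "\<And>i. i \<in> {1..n} \<Longrightarrow> d i * x i - c i * inverse (x i) = b * (c i - d i)"
  shows "det1 n (\<lambda>i j. c i * factorial_power (x i) a (q j)
                     - d i * factorial_power (inverse (x i)) a (q j)) =
         (\<Prod>i=1..n. c i - d i) *
         det1 n (\<lambda>i j. (((1 + fps_const b * fps_X) * (geom (x i) * geom (inverse (x i))))
                          * param_prod a (q j)) $ q j)"
  unfolding det1_scale_rows[symmetric]
proof (rule det1_cong)
  fix i j assume "1 \<le> i" "i \<le> n"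
  then have "fps_const (d i * x i - c i * inverse (x i)) = fps_const (b * (c i - d i))"
    using assms by simp
  then have "fps_const (d i) * fps_const (x i) - fps_const (c i) * fps_const (inverse (x i)) =
      fps_const b * fps_const (c i - d i)"
    by simp
  then have "fps_const (c i) * geom (x i) - fps_const (d i) * geom (inverse (x i)) =
      fps_const (c i - d i) * ((1 + fps_const b * fps_X) * (geom (x i) * geom (inverse (x i))))"
    by (subst linear_combination_inverses[OF geom_mult geom_mult]) (simp add: algebra_simps)
  then have "(fps_const (c i) * geom (x i) - fps_const (d i) * geom (inverse (x i))) * P =
      fps_const (c i - d i) * (((1 + fps_const b * fps_X) * (geom (x i) * geom (inverse (x i)))) * P)"
    for P by (simp only: mult.assoc)
  then have "((fps_const (c i) * geom (x i) - fps_const (d i) * geom (inverse (x i))) * P) $ k =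
      (c i - d i) * (((1 + fps_const b * fps_X) * (geom (x i) * geom (inverse (x i)))) * P) $ k"
    for P k by (simp only: fps_mult_left_const_nth)
  then show "c i * factorial_power (x i) a (q j) - d i * factorial_power (inverse (x i)) a (q j) =
      (c i - d i) * (((1 + fps_const b * fps_X) * (geom (x i) * geom (inverse (x i))))
                          * param_prod a (q j)) $ q j"
    by (simp only: factorial_power_eq left_diff_distrib fps_sub_nth mult.assoc fps_mult_left_const_nth)
qed

lemma sp_factorial_flagged:
  assumes n: "n \<ge> 1" and x: "\<forall>i\<in>{1..n}. x i \<noteq> 0" and den: "sp_den n x a \<noteq> 0"
  shows "sp_char n lam x a
           = det1 n (\<lambda>i j. h_sp (int (lam j) - int j + int i) (vars_from n x i) a)"
proof -
  define d where "d i = x i - inverse (x i)" for i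
  define F H where "F i q = ((0 + 1 * (geom (x i) * geom (inverse (x i)))) * param_prod a q) $ q"
    and "H i q = (((if i = n then 0 else 0) + fps_X ^ (n - i) *
          (1 * (\<Prod>k=i..n. geom (x k) * geom (inverse (x k))))) * param_prod a q) $ q" for i q
  have F: "det1 n (\<lambda>i j. x i * factorial_power (x i) a (q j)
                     - inverse (x i) * factorial_power (inverse (x i)) a (q j)) =
           (\<Prod>i=1..n. d i) * det1 n (\<lambda>i j. F i (q j))" for q
    using det1_factorial_difference[of n "\<lambda>i. inverse (x i)" x x 0 a q] x
    by (simp add: d_def F_def)
  have H: "det1 n (\<lambda>i j. h_sp (int (lam j) - int j + int i) (vars_from n x i) a) =
           det1 n (\<lambda>i j. H i (lam j + n - j))"
    by (rule det1_cong) (simp add: h_sp_def coeff_int_param_prod prod_list_vars_from H_def del: One_nat_def)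
  \<comment> \<open>The denominator of the character is the product of these two factors; the first
    one also occurs in the numerator and cancels.\<close>
  have nz: "(\<Prod>i=1..n. d i) \<noteq> 0" "det1 n (\<lambda>i j. F i (n - j)) \<noteq> 0"
    using den unfolding sp_den_def F by auto
  have "det1 n (\<lambda>i j. H i (lam j + n - j)) * det1 n (\<lambda>i j. F i (n - j)) =
        (1 + 0 $ 0) * det1 n (\<lambda>i j. F i (lam j + n - j))"
    using nz(2) unfolding F_def H_def by (intro det1_flagged_symplectic n x) auto
  then show ?thesis
    using nz unfolding sp_char_def sp_den_def F H by (simp add: field_simps)
qed

lemma so_factorial_flagged:
  assumes n: "n \<ge> 1" and x: "\<forall>i\<in>{1..n}. x i \<noteq> 0" and s: "\<forall>i\<in>{1..n}. s i ^ 2 = x i"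
    and den: "so_den n s x a \<noteq> 0"
  shows "so_char n lam s x a
           = det1 n (\<lambda>i j. h_oo (int (lam j) - int j + int i) (vars_from n x i) a)"
proof -
  define d where "d i = s i - inverse (s i)" for i
  define F H where
    "F i q = ((0 + (1 + fps_X) * (geom (x i) * geom (inverse (x i)))) * param_prod a q) $ q"
    and "H i q = (((if i = n then 0 else 0) + fps_X ^ (n - i) *
          ((1 + fps_X) * (\<Prod>k=i..n. geom (x k) * geom (inverse (x k))))) * param_prod a q) $ q"
    for i q
  have F: "det1 n (\<lambda>i j. s i * factorial_power (x i) a (q j)
                     - inverse (s i) * factorial_power (inverse (x i)) a (q j)) =
           (\<Prod>i=1..n. d i) * det1 n (\<lambda>i j. F i (q j))" for q
  proof -
    have "inverse (s i) * x i = s i" "s i * inverse (x i) = inverse (s i)" if "i \<in> {1..n}" for i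
    proof -
      have "x i = s i * s i" "s i \<noteq> 0"
        using x s that by (metis power2_eq_square, metis power_zero_numeral)
      then show "inverse (s i) * x i = s i" "s i * inverse (x i) = inverse (s i)"
        by simp_all
    qed
    then show ?thesis
      using det1_factorial_difference[of n "\<lambda>i. inverse (s i)" x s 1 a q]
      by (simp add: d_def F_def)
  qed
  have H: "det1 n (\<lambda>i j. h_oo (int (lam j) - int j + int i) (vars_from n x i) a) =
           det1 n (\<lambda>i j. H i (lam j + n - j))"
    by (rule det1_cong) (simp add: h_oo_def coeff_int_param_prod prod_list_vars_from H_def del: One_nat_def)
  have nz: "(\<Prod>i=1..n. d i) \<noteq> 0" "det1 n (\<lambda>i j. F i (n - j)) \<noteq> 0"
    using den unfolding so_den_def F by auto
  have "det1 n (\<lambda>i j. H i (lam j + n - j)) * det1 n (\<lambda>i j. F i (n - j)) =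
        (1 + 0 $ 0) * det1 n (\<lambda>i j. F i (lam j + n - j))"
    using nz(2) unfolding F_def H_def by (intro det1_flagged_symplectic n x) auto
  then show ?thesis
    using nz unfolding so_char_def so_den_def F H by (simp add: field_simps)
qed

text \<open>Here \<open>e = 1\<close> and \<open>B = 1 - t^2\<close>: the extra 1 in the sum of two
  geometric series is what sets the one-variable case of \<open>h_eo\<close> apart. The resulting
  factor \<open>1 + e $ 0 = 2\<close> matches the \<open>1 / 2\<close> in \<open>o_den\<close>, and
  \<open>eta\<close> comes from the last column.\<close>

lemma o_factorial_flagged:
  assumes n: "n \<ge> 1" and x: "\<forall>i\<in>{1..n}. x i \<noteq> 0" and den: "o_den n x a \<noteq> 0"
  shows "o_char n lam x a
           = det1 n (\<lambda>i j. h_eo (int (lam j) - int j + int i) (vars_from n x i) a)"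
proof -
  define F H where
    "F i q = ((1 + (1 - fps_X ^ 2) * (geom (x i) * geom (inverse (x i)))) * param_prod a q) $ q"
    and "H i q = (((if i = n then 1 else 0) + fps_X ^ (n - i) *
          ((1 - fps_X ^ 2) * (\<Prod>k=i..n. geom (x k) * geom (inverse (x k))))) * param_prod a q) $ q"
    for i q
  define eta :: 'a where "eta = (if lam n = 0 then 1 / 2 else 1)"
  \<comment> \<open>In characteristic 2 the value of \<open>1 / 2\<close> is 0 by the convention for
    division by zero, so \<open>o_den\<close> would vanish.\<close>
  have two: "(2::'a) \<noteq> 0"
    using den by (auto simp: o_den_def)
  have geom_sum: "geom y + geom (inverse y) = 1 + (1 - fps_X ^ 2) * (geom y * geom (inverse y))"
    if "y \<noteq> 0" for y :: 'a
  proof -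
    define D where "D = 1 + fps_X ^ 2 - fps_X * fps_const (y + inverse y)"
    have D: "D * inverse D = 1"
      unfolding D_def by (rule inverse_mult_eq_1') simp
    have "geom y + geom (inverse y) =
        (2 - fps_X * fps_const (y + inverse y)) * (geom y * geom (inverse y))"
      \<comment> \<open>With \<open>d = -1\<close> the difference becomes the sum, and
        \<open>c - d\<close> gives the constant 2.\<close>
      using linear_combination_inverses[OF geom_mult[of y] geom_mult[of "inverse y"], of 1 "- 1"]
      by (simp add: algebra_simps flip: fps_const_add fps_const_sub fps_const_neg)
    also have "2 - fps_X * fps_const (y + inverse y) = D + (1 - fps_X ^ 2)"
      by (simp add: D_def)
    also have "geom y * geom (inverse y) = inverse D"
      unfolding D_def using that by (rule geom_mult_geom_inverse)
    finally show ?thesis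
      unfolding geom_mult_geom_inverse[OF that] D_def[symmetric]
      by (simp only: distrib_right D)
  qed
  have F: "det1 n (\<lambda>i j. factorial_power (x i) a (q j) + factorial_power (inverse (x i)) a (q j)) =
           det1 n (\<lambda>i j. F i (q j))" for q
    using x by (intro det1_cong)
      (simp add: factorial_power_eq F_def flip: geom_sum fps_add_nth distrib_right)
  have H: "h_eo (int (lam j) - int j + int i) (vars_from n x i) a =
           H i (lam j + n - j) * (if j = n then eta else 1)"
    if ij: "1 \<le> i" "i \<le> n" "1 \<le> j" "j \<le> n" for i j
  proof (cases "i = n")
    case False
    then have "length (vars_from n x i) \<noteq> 1" using ij by (simp add: vars_from_def)
    then have "h_eo (int (lam j) - int j + int i) (vars_from n x i) a = H i (lam j + n - j)"
      using ij False by (simp add: h_eo_def coeff_int_param_prod prod_list_vars_from H_def del: One_nat_def)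
    \<comment> \<open>In this column the degree read off is 0, while a row \<open>i < n\<close>
      carries a positive power of t; scaling a zero entry by \<open>eta\<close> changes
      nothing.\<close>
    moreover have "H i (lam j + n - j) = 0" if "j = n" "lam n = 0"
      using that False ij by (simp add: H_def mult.assoc fps_X_power_mult_nth)
    ultimately show ?thesis by (auto simp: eta_def)
  next
    case True
    define q where "q = lam j + n - j"
    have v: "vars_from n x n = [x n]" by (simp add: vars_from_def)
    have k: "int (lam j) - int j + int i = int q"
      using True ij by (simp add: q_def)
    have Hn: "H n q = ((geom (x n) + geom (inverse (x n))) * param_prod a q) $ q"
      using x n by (simp add: H_def geom_sum)
    \<comment> \<open>The corner entry with \<open>lam n = 0\<close> is the only entry of the last
      row where the correction in \<open>h_eo\<close> is active.\<close>
    have 0: "q = 0 \<longleftrightarrow> j = n \<and> lam n = 0"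
      using ij by (cases "j = n") (auto simp: q_def)
    show ?thesis
    proof (cases "q = 0")
      case True
      \<comment> \<open>The corner of \<open>H\<close> is 2, whereas \<open>h_eo\<close> gives
        \<open>2 - 1 = 1\<close>; the factor \<open>eta = 1 / 2\<close> reconciles them.\<close>
      with 0 two have "j = n" "2 * eta = 1" by (auto simp: eta_def)
      moreover have "H n 0 = 2"
        using Hn True by (simp add: param_prod_nth_0 geom_def)
      ultimately show ?thesis
        using \<open>i = n\<close> True unfolding k q_def[symmetric]
        by (simp add: v h_eo_def coeff_int_def param_prod_nth_0 geom_def)
    next
      case False
      then have "j = n \<Longrightarrow> eta = 1" using 0 by (auto simp: eta_def)
      then show ?thesis
        using False \<open>i = n\<close> unfolding k q_def[symmetric]
        by (simp add: v h_eo_def coeff_int_def Hn)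
    qed
  qed
  have H: "det1 n (\<lambda>i j. h_eo (int (lam j) - int j + int i) (vars_from n x i) a) =
           det1 n (\<lambda>i j. H i (lam j + n - j)) * eta"
  proof -
    have "det1 n (\<lambda>i j. h_eo (int (lam j) - int j + int i) (vars_from n x i) a) =
          det1 n (\<lambda>i j. H i (lam j + n - j) * (if j = n then eta else 1))"
      by (rule det1_cong) (rule H)
    also have "\<dots> = det1 n (\<lambda>i j. H i (lam j + n - j)) * eta"
      unfolding det1_scale_cols using n by simp
    finally show ?thesis .
  qed
  have nz: "det1 n (\<lambda>i j. F i (n - j)) \<noteq> 0"
    using den unfolding o_den_def F by auto
  have "det1 n (\<lambda>i j. H i (lam j + n - j)) * det1 n (\<lambda>i j. F i (n - j)) =
        (1 + 1 $ 0) * det1 n (\<lambda>i j. F i (lam j + n - j))"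
    using nz unfolding F_def H_def by (intro det1_flagged_symplectic n x) auto
  then have "det1 n (\<lambda>i j. H i (lam j + n - j)) =
      2 * det1 n (\<lambda>i j. F i (lam j + n - j)) / det1 n (\<lambda>i j. F i (n - j))"
    using nz by (simp add: field_simps)
  then show ?thesis
    using nz two unfolding o_char_def o_den_def F H eta_def[symmetric] by simp
qed

theorem theorem1:
  fixes n :: nat and lam :: "nat \<Rightarrow> nat" and x a :: "nat \<Rightarrow> 'a::field"
  assumes "n \<ge> 1"
    and "antimono_on {1..n} lam"
    and "\<forall>i\<in>{1..n}. x i \<noteq> 0"
  shows
    "(gl_den n x a \<noteq> 0 \<longrightarrow>
        gl_char n lam x a
          = det1 n (\<lambda>i j. h_gl (int (lam j) - int j + int i) (vars_from n x i) a)) \<and>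
     (sp_den n x a \<noteq> 0 \<longrightarrow>
        sp_char n lam x a
          = det1 n (\<lambda>i j. h_sp (int (lam j) - int j + int i) (vars_from n x i) a)) \<and>
     (\<forall>s. (\<forall>i\<in>{1..n}. s i ^ 2 = x i) \<and> so_den n s x a \<noteq> 0 \<longrightarrow>
        so_char n lam s x a
          = det1 n (\<lambda>i j. h_oo (int (lam j) - int j + int i) (vars_from n x i) a)) \<and>
     (o_den n x a \<noteq> 0 \<longrightarrow>
        o_char n lam x a
          = det1 n (\<lambda>i j. h_eo (int (lam j) - int j + int i) (vars_from n x i) a))"
  using assms(1,3)
  by (blast intro: gl_factorial_flagged sp_factorial_flagged so_factorial_flagged
      o_factorial_flagged)

end
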